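(* Let $a,b,d$ be real numbers with $b\geqslant 0$ and $d\geqslant a\geqslant 0$, let $q$ be an indeterminate, and let $\{T_n(q)\}_{n\geqslant0}$ be the sequence of polynomials in $q$ defined by $$\sum_{n\geqslant 0}\frac{T_n(q)}{n!}x^n=\left(\frac{(1-q)e^{a(1-q)x}}{1-q e^{d(1-q)x}}\right)^b .$$ Then $\{T_n(q)\}_{n\geqslant 0}$ is a strongly $q$-log-convex sequence.
   Context: Generating functions are formal power series in $x$; the base of the $b$-th power has constant term $1$ in $x$, so its real power is defined formally (e.g. $F^b=\exp(b\log F)$). For real polynomials $f(q),g(q)$, write $f(q)\geqslant_q g(q)$ if $f(q)-g(q)$ has only nonnegative coefficients as a polynomial in $q$. A sequence $\{f_n(q)\}_{n\geqslant0}$ of real polynomials is strongly $q$-log-convex if $f_{m-1}(q)f_{n+1}(q)\geqslant_q f_m(q)f_n(q)$ for all $n\geqslant m\geqslant 1$. *)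

theory Defs
  imports "HOL-Computational_Algebra.Computational_Algebra"
begin

unbundle fps_syntax

definition coeff_ge :: "real poly \<Rightarrow> real poly \<Rightarrow> bool"  (infix \<open>\<ge>\<^sub>q\<close> 50) where
  "f \<ge>\<^sub>q g \<longleftrightarrow> (\<forall>i. coeff (f - g) i \<ge> 0)"

definition strongly_q_log_convex :: "(nat \<Rightarrow> real poly) \<Rightarrow> bool" where
  "strongly_q_log_convex f \<longleftrightarrow>
     (\<forall>m n. 1 \<le> m \<and> m \<le> n \<longrightarrow> f (m - 1) * f (n + 1) \<ge>\<^sub>q f m * f n)"

text \<open>
  Formal powers \<open>F\<^sup>c = exp (c log F)\<close>, meaningful only if \<open>F $ 0 = 1\<close>. The library series
  \<open>fps_ln 1\<close> is the expansion of \<open>log (1 + X)\<close>, whence the composition with \<open>F - 1\<close>.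
\<close>
definition fps_formal_power :: "'a::field_char_0 fps \<Rightarrow> 'a \<Rightarrow> 'a fps" where
  "fps_formal_power F c = fps_exp 1 oo (fps_const c * (fps_ln 1 oo (F - 1)))"

text \<open>
  All generating functions are power series in \<open>x\<close> over the field \<open>\<real>(q)\<close>, the fraction field of
  \<open>\<real>[q]\<close>; the field is needed because \<open>1 - q exp (d (1 - q) x)\<close> has constant term \<open>1 - q\<close> in \<open>x\<close>,
  which is not invertible in \<open>\<real>[q]\<close>.
\<close>
definition real_const :: "real \<Rightarrow> real poly fract" where
  "real_const r = to_fract [:r:]"

definition qvar :: "real poly fract" where
  "qvar = to_fract [:0, 1:]"

definition base_series :: "real \<Rightarrow> real \<Rightarrow> real poly fract fps" where
  "base_series a d =
     (fps_const (1 - qvar) * fps_exp (real_const a * (1 - qvar))) /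
     (1 - fps_const qvar * fps_exp (real_const d * (1 - qvar)))"

definition has_egf :: "(nat \<Rightarrow> real poly) \<Rightarrow> real poly fract fps \<Rightarrow> bool" where
  "has_egf T F \<longleftrightarrow> Abs_fps (\<lambda>n. to_fract (T n) / of_nat (fact n)) = F"

lemma base_series_nth_0: "base_series a d $ 0 = 1"
proof -
  have "qvar \<noteq> 1"
    unfolding qvar_def to_fract_1[symmetric] to_fract_eq_iff by (simp add: one_pCons)
  then show ?thesis
    by (simp add: base_series_def fps_divide_unit)
qed

end

theory Submission
  imports Defs
begin

text \<open>
  Let \<open>F\<close> be the base, \<open>G = F\<^sup>b\<close> and \<open>E = exp (d (1 - q) x)\<close>. The logarithmic derivative of \<open>F\<close> is
  \<open>a + (d - a) q + d q \<phi>\<close> with \<open>\<phi> = (E - 1) / (1 - q E)\<close>, and \<open>\<phi>\<close> vanishes at \<open>x = 0\<close> and solves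
  the Riccati equation \<open>\<phi>' = d (1 + \<phi>) (1 + q \<phi>)\<close>. Hence the series \<open>g\<^sub>k = G \<phi>\<^sup>k\<close> satisfy a system
  in which each derivative only involves the neighbouring indices:
  \<open>g\<^sub>k' = \<alpha>\<^sub>k g\<^sub>k\<^sub>-\<^sub>1 + s\<^sub>k g\<^sub>k + \<gamma>\<^sub>k g\<^sub>k\<^sub>+\<^sub>1\<close>, where
  \<open>\<alpha>\<^sub>k = d k\<close>, \<open>s\<^sub>k = (d k + b a) + (d k + b (d - a)) q\<close> and \<open>\<gamma>\<^sub>k = d (b + k) q\<close>
  (\<open>deriv_formal_power_riccati_power\<close>).

  Comparing coefficients of \<open>x\<close>, the series \<open>g\<^sub>k\<close> are the exponential generating functions of the
  columns of an array \<open>B\<close> whose rows arise from the first unit vector by repeated multiplication by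
  one tridiagonal matrix \<open>J\<close>, with entries \<open>\<alpha>\<^sub>k\<close>, \<open>s\<^sub>k\<close>, \<open>\<gamma>\<^sub>k\<close> in column \<open>k\<close>
  (\<open>tridiag_array_egf\<close>). In particular \<open>T\<^sub>n\<close> is the entry \<open>B\<^sub>n\<^sub>,\<^sub>0\<close>, a polynomial in \<open>q\<close>.

  As \<open>\<alpha>\<^sub>k\<close>, \<open>s\<^sub>k\<close>, \<open>\<gamma>\<^sub>k\<close> and \<open>s\<^sub>k s\<^sub>k\<^sub>+\<^sub>1 - \<alpha>\<^sub>k\<^sub>+\<^sub>1 \<gamma>\<^sub>k\<close> have nonnegative coefficients, so have all
  2-by-2 minors of \<open>J\<close>, and by the Cauchy-Binet formula those of \<open>B\<close>
  (\<open>tridiag_array_minors\<close>). The difference \<open>T\<^sub>m\<^sub>-\<^sub>1 T\<^sub>n\<^sub>+\<^sub>1 - T\<^sub>m T\<^sub>n\<close> is \<open>\<gamma>\<^sub>0\<close> times the minor of \<open>B\<close> in the rows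
  \<open>m - 1, n\<close> and the columns \<open>0, 1\<close>
  (\<open>strongly_q_log_convex_tridiag_array\<close>).
\<close>

section \<open>Polynomials with nonnegative coefficients\<close>

definition nonneg_coeffs :: "real poly \<Rightarrow> bool" where
  "nonneg_coeffs p \<longleftrightarrow> (\<forall>i. coeff p i \<ge> 0)"

lemma nonneg_coeffs_add: "nonneg_coeffs p \<Longrightarrow> nonneg_coeffs r \<Longrightarrow> nonneg_coeffs (p + r)"
  by (simp add: nonneg_coeffs_def)

lemma nonneg_coeffs_mult: "nonneg_coeffs p \<Longrightarrow> nonneg_coeffs r \<Longrightarrow> nonneg_coeffs (p * r)"
  by (simp add: nonneg_coeffs_def coeff_mult sum_nonneg)

lemma nonneg_coeffs_0: "nonneg_coeffs 0"
  by (simp add: nonneg_coeffs_def)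

lemma nonneg_coeffs_1: "nonneg_coeffs 1"
  by (simp add: nonneg_coeffs_def)

lemma nonneg_coeffs_pCons: "c \<ge> 0 \<Longrightarrow> nonneg_coeffs p \<Longrightarrow> nonneg_coeffs (pCons c p)"
  by (simp add: nonneg_coeffs_def coeff_pCons split: nat.split)

lemmas nonneg_coeffs_intros =
  nonneg_coeffs_0 nonneg_coeffs_1 nonneg_coeffs_add nonneg_coeffs_mult nonneg_coeffs_pCons

lemma coeff_ge_iff_nonneg_coeffs: "f \<ge>\<^sub>q g \<longleftrightarrow> nonneg_coeffs (f - g)"
  by (simp add: coeff_ge_def nonneg_coeffs_def)


section \<open>Second-order total positivity of tridiagonal iterates\<close>

text \<open>
  This is right multiplication of the row vector \<open>u\<close> by the tridiagonal matrix \<open>J\<close> with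
  \<open>J (k - 1) k = \<alpha> k\<close>, \<open>J k k = s k\<close> and \<open>J (k + 1) k = \<gamma> k\<close>, except that \<open>J 0 0 = \<alpha> 0 + s 0\<close>,
  because \<open>0 - 1 = 0\<close> on the natural numbers.
\<close>
definition tridiag_step ::
  "(nat \<Rightarrow> 'a::comm_ring_1) \<Rightarrow> (nat \<Rightarrow> 'a) \<Rightarrow> (nat \<Rightarrow> 'a) \<Rightarrow> (nat \<Rightarrow> 'a) \<Rightarrow> nat \<Rightarrow> 'a" where
  "tridiag_step \<alpha> s \<gamma> u k = \<alpha> k * u (k - 1) + s k * u k + \<gamma> k * u (Suc k)"

definition tridiag_array ::
  "(nat \<Rightarrow> 'a::comm_ring_1) \<Rightarrow> (nat \<Rightarrow> 'a) \<Rightarrow> (nat \<Rightarrow> 'a) \<Rightarrow> nat \<Rightarrow> nat \<Rightarrow> 'a" where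
  "tridiag_array \<alpha> s \<gamma> n = (tridiag_step \<alpha> s \<gamma> ^^ n) (\<lambda>k. if k = 0 then 1 else 0)"

lemma tridiag_array_0: "tridiag_array \<alpha> s \<gamma> 0 k = (if k = 0 then 1 else 0)"
  by (simp add: tridiag_array_def)

lemma tridiag_array_Suc:
  "tridiag_array \<alpha> s \<gamma> (Suc n) = tridiag_step \<alpha> s \<gamma> (tridiag_array \<alpha> s \<gamma> n)"
  by (simp add: tridiag_array_def)

definition row_minor :: "(nat \<Rightarrow> 'a::comm_ring_1) \<Rightarrow> (nat \<Rightarrow> 'a) \<Rightarrow> nat \<Rightarrow> nat \<Rightarrow> 'a" where
  "row_minor u v k l = u k * v l - u l * v k"

text \<open>
  The Cauchy-Binet expansion of a minor of \<open>(u J, v J)\<close> in the columns \<open>k < l\<close> only involves the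
  minors of \<open>(u, v)\<close> in columns \<open>i \<in> {k - 1, k, k + 1}\<close> and \<open>j \<in> {l - 1, l, l + 1}\<close>. Such a pair
  has \<open>i \<le> j\<close> unless \<open>l = k + 1\<close>, \<open>i = k + 1\<close> and \<open>j = k\<close>. The contribution of this exceptional pair
  is \<open>-\<alpha> (k + 1) * \<gamma> k\<close> times the minor in the columns \<open>k\<close> and \<open>k + 1\<close>, and is absorbed by the
  contribution \<open>s k * s (k + 1)\<close> times the same minor. The truncated \<open>k - 1\<close> at \<open>k = 0\<close> does no
  harm, since it also satisfies \<open>k - 1 \<le> j\<close>.
\<close>
lemma row_minor_tridiag_step:
  fixes \<alpha> s \<gamma> u v :: "nat \<Rightarrow> real poly"
  assumes nonneg: "\<And>k. nonneg_coeffs (\<alpha> k)" "\<And>k. nonneg_coeffs (s k)" "\<And>k. nonneg_coeffs (\<gamma> k)"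
    and diag: "\<And>k. nonneg_coeffs (s k * s (Suc k) - \<alpha> (Suc k) * \<gamma> k)"
    and minors: "\<And>k l. k < l \<Longrightarrow> nonneg_coeffs (row_minor u v k l)"
    and "k < l"
  shows "nonneg_coeffs (row_minor (tridiag_step \<alpha> s \<gamma> u) (tridiag_step \<alpha> s \<gamma> v) k l)"
proof -
  have minors_le: "nonneg_coeffs (row_minor u v i j)" if "i \<le> j" for i j
    using that minors[of i j] by (cases "i = j") (auto simp: row_minor_def nonneg_coeffs_0)
  have lower: "nonneg_coeffs (\<alpha> k * r * row_minor u v (k - 1) j)"
    if "nonneg_coeffs r" "k \<le> j" for r j
    using that by (intro nonneg_coeffs_mult minors_le nonneg) auto
  show ?thesis
  proof (cases "l = Suc k")
    case True
    have "row_minor (tridiag_step \<alpha> s \<gamma> u) (tridiag_step \<alpha> s \<gamma> v) k l =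
        \<alpha> k * \<alpha> l * row_minor u v (k - 1) k
      + \<alpha> k * s l * row_minor u v (k - 1) l
      + \<alpha> k * \<gamma> l * row_minor u v (k - 1) (Suc l)
      + (s k * s (Suc k) - \<alpha> (Suc k) * \<gamma> k) * row_minor u v k l
      + s k * \<gamma> l * row_minor u v k (Suc l)
      + \<gamma> k * \<gamma> l * row_minor u v l (Suc l)"
      unfolding True by (simp add: row_minor_def tridiag_step_def algebra_simps)
    then show ?thesis
      using True by (auto intro!: nonneg_coeffs_add lower nonneg nonneg_coeffs_mult diag minors_le)
  next
    case False
    have "row_minor (tridiag_step \<alpha> s \<gamma> u) (tridiag_step \<alpha> s \<gamma> v) k l =
        \<alpha> k * \<alpha> l * row_minor u v (k - 1) (l - 1)
      + \<alpha> k * s l * row_minor u v (k - 1) l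
      + \<alpha> k * \<gamma> l * row_minor u v (k - 1) (Suc l)
      + s k * \<alpha> l * row_minor u v k (l - 1)
      + s k * s l * row_minor u v k l
      + s k * \<gamma> l * row_minor u v k (Suc l)
      + \<gamma> k * \<alpha> l * row_minor u v (Suc k) (l - 1)
      + \<gamma> k * s l * row_minor u v (Suc k) l
      + \<gamma> k * \<gamma> l * row_minor u v (Suc k) (Suc l)"
      by (simp add: row_minor_def tridiag_step_def algebra_simps)
    moreover have "Suc k \<le> l - 1"
      using False \<open>k < l\<close> by simp
    ultimately show ?thesis
      using \<open>k < l\<close> by (auto intro!: nonneg_coeffs_add lower nonneg nonneg_coeffs_mult minors_le)
  qed
qed

lemma nonneg_coeffs_tridiag_array:
  assumes "\<And>k. nonneg_coeffs (\<alpha> k)" "\<And>k. nonneg_coeffs (s k)" "\<And>k. nonneg_coeffs (\<gamma> k)"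
  shows "nonneg_coeffs (tridiag_array \<alpha> s \<gamma> n k)"
proof (induction n arbitrary: k)
  case 0
  show ?case by (simp add: tridiag_array_0 nonneg_coeffs_intros)
next
  case (Suc n)
  then show ?case
    using assms by (auto simp: tridiag_array_Suc tridiag_step_def intro!: nonneg_coeffs_intros)
qed

text \<open>
  Removing a factor \<open>J\<close> from both rows reduces a minor with rows \<open>m \<le> n\<close> to one whose upper row is
  the unit vector \<open>(1, 0, 0, \<dots>)\<close>, and that minor is \<open>0\<close> or an entry of the array.
\<close>
lemma tridiag_array_minors:
  fixes \<alpha> s \<gamma> :: "nat \<Rightarrow> real poly"
  assumes nonneg: "\<And>k. nonneg_coeffs (\<alpha> k)" "\<And>k. nonneg_coeffs (s k)" "\<And>k. nonneg_coeffs (\<gamma> k)"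
    and diag: "\<And>k. nonneg_coeffs (s k * s (Suc k) - \<alpha> (Suc k) * \<gamma> k)"
    and "m \<le> n" "k < l"
  shows "nonneg_coeffs (row_minor (tridiag_array \<alpha> s \<gamma> m) (tridiag_array \<alpha> s \<gamma> n) k l)"
  using \<open>m \<le> n\<close> \<open>k < l\<close>
proof (induction m arbitrary: n k l)
  case 0
  then show ?case
    by (auto simp: row_minor_def tridiag_array_0 nonneg_coeffs_0
        intro!: nonneg_coeffs_tridiag_array nonneg)
next
  case (Suc m)
  then obtain n' where n': "n = Suc n'" "m \<le> n'"
    by (cases n) auto
  show ?case
    unfolding n' tridiag_array_Suc
    by (rule row_minor_tridiag_step[where \<alpha> = \<alpha> and s = s and \<gamma> = \<gamma>])
       (use nonneg diag Suc.IH[OF n'(2)] Suc.prems in auto)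
qed

text \<open>
  The first column \<open>T\<close> satisfies \<open>T (n + 1) = (\<alpha> 0 + s 0) * T n + \<gamma> 0 * B n 1\<close> for the array \<open>B\<close>, so the
  log-convexity determinants of \<open>T\<close> are \<open>\<gamma> 0\<close> times minors in the columns \<open>0\<close> and \<open>1\<close>.
\<close>
lemma strongly_q_log_convex_tridiag_array:
  fixes \<alpha> s \<gamma> :: "nat \<Rightarrow> real poly"
  assumes nonneg: "\<And>k. nonneg_coeffs (\<alpha> k)" "\<And>k. nonneg_coeffs (s k)" "\<And>k. nonneg_coeffs (\<gamma> k)"
    and diag: "\<And>k. nonneg_coeffs (s k * s (Suc k) - \<alpha> (Suc k) * \<gamma> k)"
  shows "strongly_q_log_convex (\<lambda>n. tridiag_array \<alpha> s \<gamma> n 0)"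
  unfolding strongly_q_log_convex_def coeff_ge_iff_nonneg_coeffs
proof (intro allI impI, elim conjE)
  fix m n :: nat
  assume "1 \<le> m" "m \<le> n"
  then obtain m' where m': "m = Suc m'"
    by (cases m) auto
  let ?B = "tridiag_array \<alpha> s \<gamma>"
  have "?B (m - 1) 0 * ?B (n + 1) 0 - ?B m 0 * ?B n 0 = \<gamma> 0 * row_minor (?B m') (?B n) 0 1"
    by (simp add: m' tridiag_array_Suc tridiag_step_def row_minor_def algebra_simps)
  moreover have "nonneg_coeffs (row_minor (?B m') (?B n) 0 1)"
    by (rule tridiag_array_minors) (use assms \<open>m \<le> n\<close> m' in auto)
  ultimately show "nonneg_coeffs (?B (m - 1) 0 * ?B (n + 1) 0 - ?B m 0 * ?B n 0)"
    by (simp add: nonneg_coeffs_mult nonneg)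
qed


section \<open>Exponential generating functions of the columns\<close>

text \<open>
  Differentiation shifts the sequence of an exponential generating function, so the differential
  system for the columns is the recurrence that defines the rows.
\<close>
lemma tridiag_array_egf:
  fixes g :: "nat \<Rightarrow> real poly fract fps"
  assumes deriv: "\<And>k. fps_deriv (g k) = fps_const (to_fract (\<alpha> k)) * g (k - 1) +
      fps_const (to_fract (s k)) * g k + fps_const (to_fract (\<gamma> k)) * g (Suc k)"
    and init: "\<And>k. g k $ 0 = (if k = 0 then 1 else 0)"
  shows "g k $ n = to_fract (tridiag_array \<alpha> s \<gamma> n k) / of_nat (fact n)"
proof (induction n arbitrary: k)
  case 0
  show ?case by (simp add: init tridiag_array_0)
next
  case (Suc n)
  have "of_nat (Suc n) * g k $ Suc n = fps_deriv (g k) $ n"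
    by simp
  also have "\<dots> = to_fract (tridiag_array \<alpha> s \<gamma> (Suc n) k) / of_nat (fact n)"
    unfolding deriv by (simp add: Suc.IH tridiag_array_Suc tridiag_step_def add_divide_distrib)
  finally have "g k $ Suc n =
      to_fract (tridiag_array \<alpha> s \<gamma> (Suc n) k) / of_nat (fact n) / of_nat (Suc n)"
    by (metis nonzero_mult_div_cancel_left of_nat_neq_0)
  then show ?case
    by (simp add: algebra_simps)
qed

lemma fps_formal_power_nth_0: "fps_formal_power F c $ 0 = 1"
  by (simp add: fps_formal_power_def)

text \<open>
  Formally, \<open>log F\<close> has the derivative \<open>F' / F = L\<close>, so \<open>F\<^sup>c = exp (c log F)\<close> has the logarithmic
  derivative \<open>c L\<close>.
\<close>
lemma fps_deriv_formal_power:
  fixes F :: "'a::field_char_0 fps"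
  assumes F0: "F $ 0 = 1" and FL: "fps_deriv F = F * L"
  shows "fps_deriv (fps_formal_power F c) = fps_const c * L * fps_formal_power F c"
proof -
  have "fps_deriv (fps_ln 1 oo (F - 1)) = (inverse (1 + fps_X) oo (F - 1)) * fps_deriv F"
    using F0 by (simp add: fps_compose_deriv fps_ln_deriv divide_inverse)
  also have "inverse (1 + fps_X) oo (F - 1) = inverse F"
    using F0 by (simp add: fps_inverse_compose fps_compose_add_distrib)
  also have "inverse F * fps_deriv F = L"
    using F0 by (simp add: FL mult.assoc[symmetric] inverse_mult_eq_1)
  finally have "fps_deriv (fps_const c * (fps_ln 1 oo (F - 1))) = fps_const c * L"
    by simp
  then show ?thesis
    by (simp add: fps_formal_power_def fps_compose_deriv fps_const_mult_apply_left mult_ac)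
qed

lemma real_const_add: "real_const (x + y) = real_const x + real_const y"
  by (simp add: real_const_def flip: to_fract_add)

lemma real_const_diff: "real_const (x - y) = real_const x - real_const y"
  by (simp add: real_const_def flip: to_fract_diff)

lemma real_const_mult: "real_const (x * y) = real_const x * real_const y"
  by (simp add: real_const_def flip: to_fract_mult)

lemma real_const_of_nat: "real_const (of_nat n) = of_nat n"
  by (induction n) (simp_all add: real_const_add, simp_all add: real_const_def flip: one_pCons)

lemma to_fract_linear: "to_fract [:x, y:] = real_const x + real_const y * qvar"
  by (simp add: real_const_def qvar_def flip: to_fract_add to_fract_mult)

lemma real_const_zero: "real_const 0 = 0"
  by (simp add: real_const_def)

lemma qvar_neq_1: "qvar \<noteq> 1"
  unfolding qvar_def to_fract_1[symmetric] to_fract_eq_iff by (simp add: one_pCons)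


text \<open>
  In the expansion of the base, \<open>E = exp (d (1 - q) x)\<close> enters through a fractional linear
  transformation. It solves a Riccati equation in \<open>x\<close>, in which \<open>q\<close> only occurs polynomially.
\<close>
definition riccati_series :: "real \<Rightarrow> real poly fract fps" where
  "riccati_series d = (fps_exp (real_const d * (1 - qvar)) - 1) /
     (1 - fps_const qvar * fps_exp (real_const d * (1 - qvar)))"

lemma riccati_series_nth_0: "riccati_series d $ 0 = 0"
  using qvar_neq_1 by (simp add: riccati_series_def fps_divide_unit)

lemma one_minus_qvar_exp_neq_0: "1 - fps_const qvar * fps_exp c \<noteq> 0"
proof
  assume "1 - fps_const qvar * fps_exp c = 0"
  then have "(1 - fps_const qvar * fps_exp c) $ 0 = 0"
    by simp
  then show False
    using qvar_neq_1 by simp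
qed

lemma riccati_series_times_denominator:
  "riccati_series d * (1 - fps_const qvar * fps_exp (real_const d * (1 - qvar))) =
     fps_exp (real_const d * (1 - qvar)) - 1"
  using qvar_neq_1 unfolding riccati_series_def
  by (simp add: fps_divide_unit mult.assoc inverse_mult_eq_1)

lemma base_series_times_denominator:
  "base_series a d * (1 - fps_const qvar * fps_exp (real_const d * (1 - qvar))) =
     fps_const (1 - qvar) * fps_exp (real_const a * (1 - qvar))"
  using qvar_neq_1 unfolding base_series_def
  by (simp add: fps_divide_unit mult.assoc inverse_mult_eq_1 del: fps_const_sub fps_const_mult)

text \<open>
  The constants match because \<open>(1 + \<phi>) D = (1 - q) E\<close> and \<open>(1 + q \<phi>) D = 1 - q\<close> for the denominator
  \<open>D = 1 - q E\<close> of \<open>\<phi>\<close>, while the quotient rule gives \<open>\<phi>' D\<^sup>2 = d (1 - q)\<^sup>2 E\<close>.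
\<close>
lemma deriv_riccati_series:
  "fps_deriv (riccati_series d) =
     fps_const (real_const d) * (1 + riccati_series d) * (1 + fps_const qvar * riccati_series d)"
proof -
  define E where "E = fps_exp (real_const d * (1 - qvar))"
  define D where "D = 1 - fps_const qvar * E"
  define Q where "Q = fps_const qvar"
  define \<delta> where "\<delta> = fps_const (real_const d)"
  let ?\<phi> = "riccati_series d"
  have \<phi>D: "?\<phi> * D = E - 1"
    unfolding D_def E_def by (rule riccati_series_times_denominator)
  have DQ: "D = 1 - Q * E"
    by (simp add: D_def Q_def)
  have E': "fps_deriv E = \<delta> * (1 - Q) * E"
    by (simp add: E_def \<delta>_def Q_def flip: fps_const_mult fps_const_sub)
  have D': "fps_deriv D = - (Q * \<delta> * (1 - Q) * E)"
    unfolding D_def by (simp add: E' Q_def mult_ac)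
  have "fps_deriv ?\<phi> * D + ?\<phi> * fps_deriv D = fps_deriv E"
    using arg_cong[OF \<phi>D, of fps_deriv] by (simp add: add.commute)
  then have "(fps_deriv ?\<phi> - \<delta> * (1 + ?\<phi>) * (1 + Q * ?\<phi>)) * D * D = 0"
    using \<phi>D DQ unfolding D' E' by algebra
  moreover have "D \<noteq> 0"
    unfolding D_def E_def by (rule one_minus_qvar_exp_neq_0)
  ultimately show ?thesis
    by (simp add: \<delta>_def Q_def)
qed

text \<open>
  The denominator contributes \<open>d q (1 - q) E / (1 - q E) = d q (1 + \<phi>)\<close> to the logarithmic
  derivative.
\<close>
lemma deriv_base_series:
  "fps_deriv (base_series a d) = base_series a d *
     (fps_const (real_const a * (1 - qvar) + real_const d * qvar)
        + fps_const (real_const d * qvar) * riccati_series d)"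
proof -
  define E where "E = fps_exp (real_const d * (1 - qvar))"
  define D where "D = 1 - fps_const qvar * E"
  define N where "N = fps_const (1 - qvar) * fps_exp (real_const a * (1 - qvar))"
  define Q where "Q = fps_const qvar"
  define \<delta> where "\<delta> = fps_const (real_const d)"
  define A where "A = fps_const (real_const a)"
  let ?\<phi> = "riccati_series d" and ?F = "base_series a d"
  have \<phi>D: "?\<phi> * D = E - 1"
    unfolding D_def E_def by (rule riccati_series_times_denominator)
  have FD: "?F * D = N"
    unfolding D_def E_def N_def by (rule base_series_times_denominator)
  have DQ: "D = 1 - Q * E"
    by (simp add: D_def Q_def)
  have E': "fps_deriv E = \<delta> * (1 - Q) * E"
    by (simp add: E_def \<delta>_def Q_def flip: fps_const_mult fps_const_sub)
  have D': "fps_deriv D = - (Q * \<delta> * (1 - Q) * E)"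
    unfolding D_def by (simp add: E' Q_def mult_ac)
  have N': "fps_deriv N = A * (1 - Q) * N"
    by (simp add: N_def A_def Q_def mult_ac flip: fps_const_mult fps_const_sub)
  have "fps_deriv ?F * D + ?F * fps_deriv D = A * (1 - Q) * N"
    using arg_cong[OF FD, of fps_deriv] by (simp add: N' add.commute)
  then have "(fps_deriv ?F - ?F * (A * (1 - Q) + \<delta> * Q + \<delta> * Q * ?\<phi>)) * D = 0"
    using \<phi>D FD DQ unfolding D' by algebra
  moreover have "D \<noteq> 0"
    unfolding D_def E_def by (rule one_minus_qvar_exp_neq_0)
  ultimately have "fps_deriv ?F = ?F * (A * (1 - Q) + \<delta> * Q + \<delta> * Q * ?\<phi>)"
    by simp
  then show ?thesis
    by (simp add: A_def \<delta>_def Q_def flip: fps_const_mult fps_const_sub fps_const_add)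
qed

text \<open>
  As \<open>(\<phi>\<^sup>k)' = k d \<phi>\<^sup>k\<^sup>-\<^sup>1 (1 + (1 + q) \<phi> + q \<phi>\<^sup>2)\<close> and \<open>G' / G\<close> is linear in \<open>\<phi>\<close>, only the powers
  \<open>k - 1\<close>, \<open>k\<close> and \<open>k + 1\<close> of \<open>\<phi>\<close> occur. Taking \<open>\<phi>\<^sup>k\<close> in place of the more usual
  \<open>(\<phi> / d)\<^sup>k / k!\<close> covers the case \<open>d = 0\<close> too.
\<close>
lemma deriv_formal_power_riccati_power:
  fixes a b d :: real
  defines "g \<equiv> \<lambda>k. fps_formal_power (base_series a d) (real_const b) * riccati_series d ^ k"
  shows "fps_deriv (g k) =
      fps_const (to_fract [:d * of_nat k:]) * g (k - 1)
    + fps_const (to_fract [:d * of_nat k + b * a, d * of_nat k + b * (d - a):]) * g k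
    + fps_const (to_fract [:0, d * (b + of_nat k):]) * g (Suc k)"
proof -
  define G where "G = fps_formal_power (base_series a d) (real_const b)"
  define \<phi> where "\<phi> = riccati_series d"
  define A B \<delta> Q K where "A = fps_const (real_const a)" and "B = fps_const (real_const b)"
    and "\<delta> = fps_const (real_const d)" and "Q = fps_const qvar"
    and "K = fps_const (of_nat k :: real poly fract)"
  have G': "fps_deriv G = B * (A * (1 - Q) + \<delta> * Q + \<delta> * Q * \<phi>) * G"
    unfolding G_def fps_deriv_formal_power[OF base_series_nth_0 deriv_base_series]
    by (simp add: A_def B_def \<delta>_def Q_def \<phi>_def flip: fps_const_mult fps_const_sub fps_const_add)
  have \<phi>': "fps_deriv \<phi> = \<delta> * (1 + \<phi>) * (1 + Q * \<phi>)"
    unfolding \<phi>_def \<delta>_def Q_def by (rule deriv_riccati_series)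
  \<comment> \<open>The factor \<open>K\<close> makes this true for \<open>k = 0\<close>, where \<open>k - 1\<close> is \<open>0\<close>.\<close>
  have K\<phi>: "K * \<phi> ^ (k - 1) * \<phi> = K * \<phi> ^ k"
    by (cases k) (simp_all add: K_def mult_ac)
  define P R where "P = \<phi> ^ (k - 1)" and "R = \<phi> ^ k"
  have "fps_deriv (G * \<phi> ^ k) = fps_deriv G * \<phi> ^ k + G * (K * fps_deriv \<phi> * \<phi> ^ (k - 1))"
    by (simp add: fps_deriv_power K_def)
  also have "\<dots> = \<delta> * K * (G * \<phi> ^ (k - 1))
      + (\<delta> * K + B * A + (\<delta> * K + B * (\<delta> - A)) * Q) * (G * \<phi> ^ k)
      + \<delta> * (B + K) * Q * (G * (\<phi> * \<phi> ^ k))"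
    unfolding G' \<phi>' using K\<phi> unfolding P_def[symmetric] R_def[symmetric] by algebra
  finally show ?thesis
    unfolding g_def G_def[symmetric] \<phi>_def[symmetric]
    by (simp add: to_fract_linear real_const_add real_const_diff real_const_mult real_const_of_nat
        real_const_zero real_const_def[symmetric]
        A_def B_def \<delta>_def Q_def K_def flip: fps_const_mult fps_const_sub fps_const_add)
qed


section \<open>Strong q-log-convexity\<close>

theorem theorem2p3:
  fixes a b d :: real
  assumes "b \<ge> 0" and "d \<ge> a" and "a \<ge> 0"
  shows "(\<exists>!T. has_egf T (fps_formal_power (base_series a d) (real_const b))) \<and>
         (\<forall>T. has_egf T (fps_formal_power (base_series a d) (real_const b)) \<longrightarrow>
              strongly_q_log_convex T)"
proof -
  define \<alpha> where "\<alpha> = (\<lambda>k. [:d * of_nat k:])"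
  define s where "s = (\<lambda>k. [:d * of_nat k + b * a, d * of_nat k + b * (d - a):])"
  define \<gamma> where "\<gamma> = (\<lambda>k. [:0, d * (b + of_nat k):])"
  define B where "B = tridiag_array \<alpha> s \<gamma>"
  let ?G = "fps_formal_power (base_series a d) (real_const b)"
  have d: "d \<ge> 0" "d - a \<ge> 0"
    using assms by auto
  have "(?G * riccati_series d ^ k) $ n = to_fract (B n k) / of_nat (fact n)" for n k
    unfolding B_def
  proof (rule tridiag_array_egf)
    show "fps_deriv (?G * riccati_series d ^ k) =
        fps_const (to_fract (\<alpha> k)) * (?G * riccati_series d ^ (k - 1))
      + fps_const (to_fract (s k)) * (?G * riccati_series d ^ k)
      + fps_const (to_fract (\<gamma> k)) * (?G * riccati_series d ^ Suc k)" for k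
      unfolding \<alpha>_def s_def \<gamma>_def by (rule deriv_formal_power_riccati_power)
    show "(?G * riccati_series d ^ k) $ 0 = (if k = 0 then 1 else 0)" for k
      by (simp add: fps_formal_power_nth_0 fps_power_zeroth riccati_series_nth_0)
  qed
  from this[of 0] have G: "?G $ n = to_fract (B n 0) / of_nat (fact n)" for n
    by simp
  have egf_iff: "has_egf T ?G \<longleftrightarrow> T = (\<lambda>n. B n 0)" for T
    by (simp add: has_egf_def fps_eq_iff G fun_eq_iff)
  have "strongly_q_log_convex (\<lambda>n. B n 0)"
    unfolding B_def
  proof (rule strongly_q_log_convex_tridiag_array)
    show "nonneg_coeffs (\<alpha> k)" "nonneg_coeffs (s k)" "nonneg_coeffs (\<gamma> k)" for k
      using assms d by (auto simp: \<alpha>_def s_def \<gamma>_def intro!: nonneg_coeffs_intros)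
    show "nonneg_coeffs (s k * s (Suc k) - \<alpha> (Suc k) * \<gamma> k)" for k
    proof -
      let ?x = "real k"
      (* In the coefficient of q, the product s k * s (Suc k) contributes
         d^2 (2 k (k + 1) + b (2 k + 1)) + 2 b^2 a (d - a), of which the other product takes away
         d^2 (k + 1) (b + k). *)
      have "s k * s (Suc k) - \<alpha> (Suc k) * \<gamma> k =
          [:(d * ?x + b * a) * (d * (?x + 1) + b * a),
            d\<^sup>2 * ?x * (?x + 1) + b * d\<^sup>2 * ?x + 2 * b\<^sup>2 * a * (d - a),
            (d * ?x + b * (d - a)) * (d * (?x + 1) + b * (d - a)):]"
        by (simp add: s_def \<alpha>_def \<gamma>_def power2_eq_square algebra_simps)
      then show ?thesis
        using assms d by (auto intro!: nonneg_coeffs_intros)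
    qed
  qed
  then show ?thesis
    by (simp add: egf_iff)
qed

end
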